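(* For every positive integer $n$, the search problem $\mathcal{P}\text{-MSP}_n(\mathbf{1})$ (searching the plane with $n$ unit-speed agents) admits a solution with search cost $$\mathcal{U}_n := \frac{\sqrt{1+\kappa_n^2}}{\kappa_n}\,e^{2\pi \kappa_n/n},$$ where $\kappa_n$ is the unique positive root of $k^3+k=\frac{n}{2\pi}$, i.e. $$\kappa_n = \sqrt[3]{\sqrt{\tfrac{n^2}{16 \pi^2}+\tfrac{1}{27}}+\tfrac{n}{4 \pi}}-\sqrt[3]{\sqrt{\tfrac{n^2}{16 \pi^2}+\tfrac{1}{27}}-\tfrac{n}{4 \pi}}.$$
   Context: Polar notation: $\langle \rho,\chi\rangle = \rho(\cos\chi,\sin\chi)$. A point $P=\langle x,\psi\rangle$ exposes $A=\langle y,\psi\rangle$ (with $x,y>0$, same ray from the origin) if $x\ge y$. $[n]=\{0,\dots,n-1\}$. $\mathcal P=\mathbb R^2\setminus\{(0,0)\}$. Problem $\mathcal D\text{-MSP}_n(c)$, for a search domain $\mathcal D\subseteq\mathbb R^2\setminus\{(0,0)\}$ and speeds $c=(c_0,\dots,c_{n-1})$: a feasible solution consists of continuous, piecewise differentiable curves $\tau_i:\mathbb R\to\mathbb R^2$, $i\in[n]$, with $\lim_{t\to-\infty}\tau_i(t)=(0,0)$, such that every $A\in\mathcal D$ is exposed by some point $\tau_i(t)$ of some curve. The parameter $t$ is not physical time: agent $i$ moves along $\tau_i$ at speed $c_i$, so it reaches $\tau_i(t)$ at time $\ell_i(t)/c_i$, where $\ell_i(t)=\int_{-\infty}^t\|\tau_i'(u)\|\,du$.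 If $t_A^i$ is the earliest parameter at which $\tau_i(t_A^i)$ exposes $A$ (infinite if none), the search cost of the solution is $\sup_{A\in\mathcal D}\frac1{\|A\|}\min_{i\in[n]}\frac{\ell_i(t_A^i)}{c_i}$. "Admits a solution with search cost $S$" means there is a feasible solution whose search cost equals $S$. Here $\mathbf 1$ denotes the all-ones vector, i.e. all speeds are $1$. *)

theory Defs
  imports "HOL-Analysis.Analysis"
begin

type_synonym point = "real \<times> real"

definition polar :: "real \<Rightarrow> real \<Rightarrow> point" where
  "polar \<rho> \<theta> = \<rho> *\<^sub>R (cos \<theta>, sin \<theta>)"

definition exposes :: "point \<Rightarrow> point \<Rightarrow> bool" where
  "exposes P A \<longleftrightarrow>
     (\<exists>x y \<psi>. x > 0 \<and> y > 0 \<and> P = polar x \<psi> \<and> A = polar y \<psi> \<and> x \<ge> y)"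

text \<open>
  Requiring piecewise differentiability on every compact interval allows infinitely many
  breakpoints on the real line, provided that they are locally finite.
\<close>

definition search_curve :: "(real \<Rightarrow> point) \<Rightarrow> bool" where
  "search_curve \<tau> \<longleftrightarrow>
     continuous_on UNIV \<tau> \<and>
     (\<forall>a b. \<tau> piecewise_differentiable_on {a..b}) \<and>
     (\<tau> \<longlongrightarrow> (0, 0)) at_bot"

definition feasible :: "point set \<Rightarrow> nat \<Rightarrow> (nat \<Rightarrow> real \<Rightarrow> point) \<Rightarrow> bool" where
  "feasible D n \<tau> \<longleftrightarrow>
     (\<forall>i<n. search_curve (\<tau> i)) \<and> (\<forall>A\<in>D. \<exists>i<n. \<exists>t. exposes (\<tau> i t) A)"

text \<open>
  Lengths, times and costs are extended nonnegative reals.  The value of \<open>vector_derivative\<close>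
  at the breakpoints of a search curve is arbitrary, but these form a null set.
\<close>

definition arc_len :: "(real \<Rightarrow> point) \<Rightarrow> real \<Rightarrow> ennreal" where
  "arc_len \<tau> t = (\<integral>\<^sup>+u\<in>{..t}. ennreal (norm (vector_derivative \<tau> (at u))) \<partial>lborel)"

text \<open>
  For a search curve, the set of parameters at which a given point is exposed is closed and
  bounded below, so that the least element exists whenever the set is nonempty.
  If an agent never exposes \<open>A\<close>, its time is infinite even if its curve has finite total length.
\<close>

definition exposure_time :: "(real \<Rightarrow> point) \<Rightarrow> real \<Rightarrow> point \<Rightarrow> ennreal" where
  "exposure_time \<tau> v A =
     (if \<exists>t. exposes (\<tau> t) A
      then arc_len \<tau> (LEAST t. exposes (\<tau> t) A) / ennreal v
      else \<infinity>)"

definition search_cost ::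
  "point set \<Rightarrow> nat \<Rightarrow> (nat \<Rightarrow> real) \<Rightarrow> (nat \<Rightarrow> real \<Rightarrow> point) \<Rightarrow> ennreal" where
  "search_cost D n c \<tau> =
     (SUP A\<in>D. (MIN i\<in>{..<n}. exposure_time (\<tau> i) (c i) A) / ennreal (norm A))"

definition MSP_admits ::
  "point set \<Rightarrow> nat \<Rightarrow> (nat \<Rightarrow> real) \<Rightarrow> ennreal \<Rightarrow> bool" where
  "MSP_admits D n c S \<longleftrightarrow> (\<exists>\<tau>. feasible D n \<tau> \<and> search_cost D n c \<tau> = S)"

definition punctured_plane :: "point set" where
  "punctured_plane = UNIV - {(0, 0)}"

definition kappa :: "nat \<Rightarrow> real" where
  "kappa n = (THE k. k > 0 \<and> k ^ 3 + k = real n / (2 * pi))"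

definition U_bound :: "nat \<Rightarrow> real" where
  "U_bound n = sqrt (1 + (kappa n)\<^sup>2) / kappa n * exp (2 * pi * kappa n / real n)"

end

theory Submission
  imports Defs
begin

text \<open>
  Agent \<open>i\<close> follows the logarithmic spiral of growth rate \<open>k\<close> rotated by \<open>2 * pi * i / n\<close>.  Up to
  parameter \<open>t\<close> it has length \<open>sqrt (1 + k\<^sup>2) / k * exp (k * t)\<close>.  The parameters at which some
  agent points in the direction of a given point \<open>A\<close> form a coset of \<open>(2 * pi / n) \<int>\<close>, so the
  agent radius at the first exposure of \<open>A\<close> is less than \<open>exp (2 * pi * k / n) * norm A\<close>, and this
  factor is approached by points lying just outside one of the spirals.
\<close>

section \<open>Polar coordinates and the exposure relation\<close>

lemma norm_polar: "norm (polar r \<theta>) = \<bar>r\<bar>"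
  by (simp add: polar_def norm_Pair power_mult_distrib flip: distrib_left)

text \<open>Norms force the witnesses in \<open>exposes\<close> to be the radii \<open>r\<close> and
  \<open>y\<close>; the common direction then leaves the two angles equal up to a multiple of
  \<open>2 * pi\<close>.\<close>

lemma exposes_polar_iff:
  assumes "r > 0" "y > 0"
  shows "exposes (polar r \<alpha>) (polar y \<theta>) \<longleftrightarrow> y \<le> r \<and> (\<exists>m::int. \<alpha> = \<theta> + 2 * pi * m)"
proof
  assume "exposes (polar r \<alpha>) (polar y \<theta>)"
  then obtain x z \<psi> where *: "x > 0" "z > 0" "polar r \<alpha> = polar x \<psi>" "polar y \<theta> = polar z \<psi>" "z \<le> x"
    unfolding exposes_def by blast
  have "x = r" "z = y"
    using arg_cong[OF *(3), of norm] arg_cong[OF *(4), of norm] assms *(1,2)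
    by (simp_all add: norm_polar)
  with * assms have "sin \<alpha> = sin \<theta> \<and> cos \<alpha> = cos \<theta>" "y \<le> r"
    by (auto simp: polar_def)
  then show "y \<le> r \<and> (\<exists>m::int. \<alpha> = \<theta> + 2 * pi * m)"
    by (simp add: sin_cos_eq_iff)
next
  assume *: "y \<le> r \<and> (\<exists>m::int. \<alpha> = \<theta> + 2 * pi * m)"
  then have "sin \<alpha> = sin \<theta> \<and> cos \<alpha> = cos \<theta>"
    by (simp add: sin_cos_eq_iff)
  then have "polar r \<alpha> = polar r \<theta>"
    by (simp add: polar_def)
  with * assms show "exposes (polar r \<alpha>) (polar y \<theta>)"
    unfolding exposes_def by blast
qed

lemma polar_in_punctured_plane: "r > 0 \<Longrightarrow> polar r \<theta> \<in> punctured_plane"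
  using norm_polar[of r \<theta>] by (auto simp: punctured_plane_def)

lemma punctured_plane_polarE:
  assumes "A \<in> punctured_plane"
  obtains r \<theta> where "r > 0" "A = polar r \<theta>"
proof -
  obtain a b where A: "A = (a, b)"
    by fastforce
  define r where "r = norm A"
  have r: "r > 0" "r\<^sup>2 = a\<^sup>2 + b\<^sup>2"
    using assms by (auto simp: r_def A punctured_plane_def norm_Pair sum_power2_gt_zero_iff)
  have "(a / r)\<^sup>2 + (b / r)\<^sup>2 = r\<^sup>2 / r\<^sup>2"
    unfolding r(2) by (simp only: power_divide r(2) add_divide_distrib)
  also have "\<dots> = 1"
    using r(1) by simp
  finally have "(a / r)\<^sup>2 + (b / r)\<^sup>2 = 1" .
  then obtain t where "a / r = cos t" "b / r = sin t"
    using sincos_total_2pi by metis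
  with r have "A = polar r t"
    by (simp add: A polar_def field_simps)
  with r that show ?thesis by blast
qed

section \<open>A single logarithmic spiral: length and first exposure\<close>

definition log_spiral :: "real \<Rightarrow> real \<Rightarrow> real \<Rightarrow> point" where
  "log_spiral k \<phi> t = polar (exp (k * t)) (t + \<phi>)"

lemma log_spiral_has_vector_derivative:
  "(log_spiral k \<phi> has_vector_derivative
     (exp (k * t) * (k * cos (t + \<phi>) - sin (t + \<phi>)),
      exp (k * t) * (k * sin (t + \<phi>) + cos (t + \<phi>)))) (at t)"
proof -
  have "log_spiral k \<phi> = (\<lambda>t. (exp (k * t) * cos (t + \<phi>), exp (k * t) * sin (t + \<phi>)))"
    by (auto simp: log_spiral_def polar_def)
  then show ?thesis
    unfolding has_vector_derivative_def
    by (auto intro!: derivative_eq_intros simp: algebra_simps)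
qed

lemma norm_vector_derivative_log_spiral:
  "norm (vector_derivative (log_spiral k \<phi>) (at t)) = sqrt (1 + k\<^sup>2) * exp (k * t)"
proof -
  \<comment> \<open>The velocity is \<open>exp (k * t)\<close> times the sum of \<open>k\<close>
    times the radial and \<open>1\<close> times the tangential unit vector. These are orthogonal, so
    the cross terms cancel.\<close>
  have "(exp (k * t) * (k * cos s - sin s))\<^sup>2 + (exp (k * t) * (k * sin s + cos s))\<^sup>2
      = (1 + k\<^sup>2) * (exp (k * t))\<^sup>2" for s
    using sin_cos_squared_add[of s] by algebra
  then show ?thesis
    unfolding vector_derivative_at[OF log_spiral_has_vector_derivative]
    by (simp add: norm_Pair real_sqrt_mult)
qed

lemma exp_mult_at_bot:
  fixes k :: real
  assumes "k > 0"
  shows "((\<lambda>t. exp (k * t)) \<longlongrightarrow> 0) at_bot"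
  by (intro filterlim_compose[OF exp_at_bot] filterlim_tendsto_pos_mult_at_bot[of _ k])
     (use assms in \<open>auto intro: filterlim_ident\<close>)

lemma arc_len_log_spiral:
  assumes "k > 0"
  shows "arc_len (log_spiral k \<phi>) t = ennreal (sqrt (1 + k\<^sup>2) / k * exp (k * t))"
proof -
  define C where "C = sqrt (1 + k\<^sup>2)"
  have "arc_len (log_spiral k \<phi>) t = (\<integral>\<^sup>+u. ennreal (C * exp (k * u)) * indicator {..t} u \<partial>lborel)"
    by (simp add: arc_len_def norm_vector_derivative_log_spiral C_def)
  \<comment> \<open>Reflecting \<open>u\<close> to \<open>- u\<close> gives a half-line unbounded
    above, where the fundamental theorem applies to an antiderivative that vanishes at infinity
    because \<open>k > 0\<close>.\<close>
  also have "\<dots> = (\<integral>\<^sup>+u. ennreal (C * exp (- k * u)) * indicator {- t..} u \<partial>lborel)"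
    by (subst nn_integral_real_affine[where c = "-1" and t = 0])
       (auto intro!: nn_integral_cong split: split_indicator)
  also have "\<dots> = ennreal (0 - - (C / k) * exp (- k * - t))"
  proof (rule nn_integral_FTC_atLeast)
    have "((\<lambda>x. - (C / k) * exp (k * - x)) \<longlongrightarrow> - (C / k) * 0) at_top"
      by (intro tendsto_mult tendsto_const
            filterlim_compose[OF exp_mult_at_bot[OF assms] filterlim_uminus_at_bot_at_top])
    then show "((\<lambda>x. - (C / k) * exp (- k * x)) \<longlongrightarrow> 0) at_top"
      by simp
  qed (use assms in \<open>auto intro!: derivative_eq_intros simp: C_def\<close>)
  finally show ?thesis
    by (simp add: C_def)
qed

lemma search_curve_log_spiral:
  assumes "k > 0"
  shows "search_curve (log_spiral k \<phi>)"
proof -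
  have diff: "log_spiral k \<phi> differentiable (at t within S)" for t S
    using differentiableI_vector[OF log_spiral_has_vector_derivative] differentiable_at_withinI
    by blast
  have "((\<lambda>t. norm (log_spiral k \<phi> t)) \<longlongrightarrow> 0) at_bot"
    using exp_mult_at_bot[OF assms] by (simp add: log_spiral_def norm_polar)
  then have "(log_spiral k \<phi> \<longlongrightarrow> 0) at_bot"
    by (rule tendsto_norm_zero_cancel)
  with diff show ?thesis
    by (auto simp: search_curve_def zero_prod_def differentiable_on_def
        intro!: differentiable_imp_piecewise_differentiable differentiable_imp_continuous_on)
qed

text \<open>The radius \<open>exp (k * t)\<close> does not depend on \<open>\<phi>\<close> and
  increases with \<open>t\<close>, reaching \<open>y\<close> at \<open>ln y / k\<close>. Only the
  condition on the direction depends on the agent.\<close>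

lemma exposes_log_spiral_iff:
  assumes "k > 0" "y > 0"
  shows "exposes (log_spiral k \<phi> t) (polar y \<theta>) \<longleftrightarrow>
    ln y / k \<le> t \<and> (\<exists>m::int. t + \<phi> = \<theta> + 2 * pi * m)"
proof -
  have "y \<le> exp (k * t) \<longleftrightarrow> ln y / k \<le> t"
    using assms by (simp add: field_simps flip: ln_le_cancel_iff)
  then show ?thesis
    using assms by (simp add: log_spiral_def exposes_polar_iff)
qed

text \<open>The exposing parameters are the elements of a coset of \<open>2 * pi\<close> times the
  integers that are at least \<open>ln y / k\<close>. Such a set has a least element, which makes
  the \<open>LEAST\<close> in \<open>exposure_time\<close> explicit.\<close>

lemma log_spiral_first_exposure:
  assumes "k > 0" "y > 0"
  obtains s where "exposes (log_spiral k \<phi> s) (polar y \<theta>)"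
    and "\<And>t. exposes (log_spiral k \<phi> t) (polar y \<theta>) \<Longrightarrow> s \<le> t"
    and "exposure_time (log_spiral k \<phi>) 1 (polar y \<theta>) = ennreal (sqrt (1 + k\<^sup>2) / k * exp (k * s))"
proof -
  \<comment> \<open>The least integer for which the coset element
    \<open>\<theta> - \<phi> + 2 * pi * m\<close> is at least \<open>ln y / k\<close>.\<close>
  define m where "m = \<lceil>(ln y / k - \<theta> + \<phi>) / (2 * pi)\<rceil>"
  define s where "s = \<theta> - \<phi> + 2 * pi * m"
  have "(ln y / k - \<theta> + \<phi>) / (2 * pi) \<le> m"
    by (simp add: m_def)
  then have "ln y / k \<le> s"
    by (simp add: s_def divide_le_eq algebra_simps)
  then have s: "exposes (log_spiral k \<phi> s) (polar y \<theta>)"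
    unfolding exposes_log_spiral_iff[OF assms] by (intro conjI exI[of _ m]) (simp_all add: s_def)
  have min: "s \<le> t" if t: "exposes (log_spiral k \<phi> t) (polar y \<theta>)" for t
  proof -
    obtain j :: int where j: "ln y / k \<le> t" "t + \<phi> = \<theta> + 2 * pi * j"
      using t unfolding exposes_log_spiral_iff[OF assms] by blast
    then have "ln y / k - \<theta> + \<phi> \<le> 2 * pi * j"
      by linarith
    then have "(ln y / k - \<theta> + \<phi>) / (2 * pi) \<le> j"
      by (simp add: divide_le_eq mult.commute)
    then have "m \<le> j"
      by (simp add: m_def ceiling_le_iff)
    then have "2 * pi * m \<le> 2 * pi * j"
      by simp
    with j show ?thesis
      unfolding s_def by linarith
  qed
  have "(LEAST t. exposes (log_spiral k \<phi> t) (polar y \<theta>)) = s"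
    using s min by (rule Least_equality)
  with s have "exposure_time (log_spiral k \<phi>) 1 (polar y \<theta>) = ennreal (sqrt (1 + k\<^sup>2) / k * exp (k * s))"
    using assms by (auto simp: exposure_time_def arc_len_log_spiral divide_ennreal simp del: ennreal_1)
  with s min that show ?thesis by blast
qed

section \<open>The family of rotated spirals: feasibility and search cost\<close>

abbreviation spirals :: "real \<Rightarrow> nat \<Rightarrow> nat \<Rightarrow> real \<Rightarrow> point" where
  "spirals k n i \<equiv> log_spiral k (2 * pi * real i / real n)"

lemma ex_spiral_exposes:
  assumes "k > 0" "y > 0" "n > 0"
  obtains i t where "i < n" "exposes (spirals k n i t) (polar y \<theta>)" "t < ln y / k + 2 * pi / n"
proof -
  \<comment> \<open>The position of \<open>ln y / k\<close> on the grid of spacing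
    \<open>2 * pi / n\<close> through \<open>\<theta>\<close>, in units of the spacing. Rounding up
    gives the grid point \<open>t\<close>, less than one spacing later.\<close>
  define x where "x = real n * (ln y / k - \<theta>) / (2 * pi)"
  define j where "j = \<lceil>x\<rceil>"
  define t where "t = \<theta> + 2 * pi * j / n"
  \<comment> \<open>At \<open>t\<close>, agent \<open>i\<close> has angle
    \<open>\<theta> + 2 * pi * (j + i) / n\<close>, which is the direction \<open>\<theta>\<close>
    exactly when \<open>n\<close> divides \<open>j + i\<close>.\<close>
  define i where "i = nat ((- j) mod int n)"
  have i: "i < n" "int i = (- j) mod int n"
    using assms by (auto simp: i_def nat_less_iff)
  have "x \<le> j" "j < x + 1"
    unfolding j_def by linarith+
  then have t: "ln y / k \<le> t" "t < ln y / k + 2 * pi / n"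
  proof -
    have "2 * pi / n * x = ln y / k - \<theta>"
      using assms by (simp add: x_def)
    moreover have "2 * pi / n * x \<le> 2 * pi / n * j" "2 * pi / n * j < 2 * pi / n * (x + 1)"
      using \<open>x \<le> j\<close> \<open>j < x + 1\<close> assms
      by (intro mult_left_mono mult_strict_left_mono; simp)+
    ultimately show "ln y / k \<le> t" "t < ln y / k + 2 * pi / n"
      by (simp_all add: t_def distrib_left)
  qed
  obtain m where "- j = int n * m + int i"
    using i by (metis mult_div_mod_eq)
  then have "j + int i = int n * (- m)"
    by simp
  then have "real_of_int j + real i = real n * - m"
    by (metis of_int_add of_int_mult of_int_of_nat_eq)
  then have "2 * pi / n * (real_of_int j + real i) = 2 * pi / n * (real n * - m)"
    by (rule arg_cong)
  then have "t + 2 * pi * real i / real n = \<theta> + 2 * pi * real_of_int (- m)"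
    using assms by (simp add: t_def distrib_left)
  with t have "exposes (spirals k n i t) (polar y \<theta>)"
    unfolding exposes_log_spiral_iff[OF assms(1,2)] by blast
  with i t that show ?thesis by blast
qed

lemma feasible_spirals:
  assumes "k > 0" "n > 0"
  shows "feasible punctured_plane n (spirals k n)"
  unfolding feasible_def
proof (intro conjI allI impI ballI)
  show "search_curve (spirals k n i)" for i
    by (rule search_curve_log_spiral[OF assms(1)])
  fix A
  assume "A \<in> punctured_plane"
  then obtain y \<theta> where "y > 0" "A = polar y \<theta>"
    by (rule punctured_plane_polarE)
  then show "\<exists>i<n. \<exists>t. exposes (spirals k n i t) A"
    using ex_spiral_exposes[OF assms(1) _ assms(2)] by blast
qed

text \<open>Some agent exposes \<open>A\<close> before \<open>ln y / k + 2 * pi / n\<close>. Its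
  first exposure is no later, so its radius there is at most \<open>exp (2 * pi * k / n)\<close>
  times \<open>y\<close>, and length is proportional to radius.\<close>

lemma exposure_ratio_le:
  assumes "k > 0" "n > 0" "A \<in> punctured_plane"
  shows "(MIN i\<in>{..<n}. exposure_time (spirals k n i) 1 A) / ennreal (norm A)
    \<le> ennreal (sqrt (1 + k\<^sup>2) / k * exp (2 * pi * k / n))"
proof -
  define C where "C = sqrt (1 + k\<^sup>2) / k"
  have C: "C \<ge> 0"
    using assms by (simp add: C_def)
  obtain y \<theta> where A: "y > 0" "A = polar y \<theta>"
    using assms punctured_plane_polarE by blast
  obtain i t where it: "i < n" "exposes (spirals k n i t) (polar y \<theta>)" "t < ln y / k + 2 * pi / n"
    using assms A ex_spiral_exposes by blast
  obtain s where s: "\<And>t. exposes (spirals k n i t) (polar y \<theta>) \<Longrightarrow> s \<le> t"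
      "exposure_time (spirals k n i) 1 A = ennreal (C * exp (k * s))"
    using log_spiral_first_exposure[of k y] assms A C_def by metis
  have "s < ln y / k + 2 * pi / n"
    using s(1)[OF it(2)] it(3) by simp
  then have "k * s \<le> ln y + 2 * pi * k / n"
    using assms by (simp add: field_simps)
  then have "exp (k * s) \<le> exp (ln y + 2 * pi * k / n)"
    by simp
  then have "exp (k * s) / y \<le> exp (2 * pi * k / n)"
    using A by (simp add: exp_add divide_le_eq mult.commute)
  then have "C * exp (k * s) / y \<le> C * exp (2 * pi * k / n)"
    using mult_left_mono[OF _ C] by fastforce
  then have "exposure_time (spirals k n i) 1 A / ennreal (norm A) \<le> ennreal (C * exp (2 * pi * k / n))"
    using A C s(2) by (simp add: norm_polar divide_ennreal ennreal_leI)
  moreover have "(MIN i\<in>{..<n}. exposure_time (spirals k n i) 1 A) \<le> exposure_time (spirals k n i) 1 A"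
    using it by (intro Min_le) auto
  ultimately show ?thesis
    unfolding C_def by (meson divide_right_mono_ennreal order_trans)
qed

text \<open>Agents point along the positive first axis only at multiples of
  \<open>2 * pi / n\<close>. At parameter \<open>0\<close> the radius is \<open>1\<close>, too short
  for the point of radius \<open>exp (k * \<epsilon>)\<close>, so every agent needs a parameter of
  at least \<open>2 * pi / n\<close>.\<close>

lemma exposure_ratio_ge:
  assumes "k > 0" "n > 0" "\<epsilon> > 0"
  shows "ennreal (sqrt (1 + k\<^sup>2) / k * exp (k * (2 * pi / n - \<epsilon>)))
    \<le> (MIN i\<in>{..<n}. exposure_time (spirals k n i) 1 (polar (exp (k * \<epsilon>)) 0))
        / ennreal (norm (polar (exp (k * \<epsilon>)) 0))"
proof -
  define C where "C = sqrt (1 + k\<^sup>2) / k"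
  have C: "C \<ge> 0"
    using assms by (simp add: C_def)
  define A where "A = polar (exp (k * \<epsilon>)) 0"
  have "ennreal (C * exp (k * (2 * pi / n))) \<le> exposure_time (spirals k n i) 1 A" for i
  proof -
    obtain s where s: "exposes (spirals k n i s) A"
        "exposure_time (spirals k n i) 1 A = ennreal (C * exp (k * s))"
      using log_spiral_first_exposure[of k "exp (k * \<epsilon>)"] assms C_def A_def by (metis exp_gt_zero)
    then obtain m :: int where m: "\<epsilon> \<le> s" "s + 2 * pi * real i / real n = 2 * pi * m"
      using assms by (auto simp: A_def exposes_log_spiral_iff)
    then have s_eq: "s = 2 * pi / n * real_of_int (int n * m - int i)"
      using assms by (simp add: field_simps)
    moreover have "s > 0"
      using m assms by simp
    \<comment> \<open>Positivity of \<open>s\<close> comes from \<open>\<epsilon> \<le> s\<close>;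
      integrality then lifts the bound on \<open>s\<close> to a full grid step.\<close>
    ultimately have "real_of_int (int n * m - int i) > 0"
      using assms by (metis divide_pos_pos zero_less_mult_pos of_nat_0_less_iff pi_gt_zero
          zero_less_numeral mult_pos_pos)
    then have "real_of_int (int n * m - int i) \<ge> 1"
      by (metis of_int_0_less_iff of_int_1_le_iff int_one_le_iff_zero_less)
    then have "2 * pi / n * 1 \<le> s"
      unfolding s_eq by (intro mult_left_mono) auto
    then have "C * exp (k * (2 * pi / n)) \<le> C * exp (k * s)"
      using C assms by (intro mult_left_mono) (simp_all del: times_divide_eq_right)
    then show ?thesis
      by (simp add: s ennreal_leI)
  qed
  then have "ennreal (C * exp (k * (2 * pi / n))) \<le> (MIN i\<in>{..<n}. exposure_time (spirals k n i) 1 A)"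
    using assms by (subst Min_ge_iff) auto
  then have "ennreal (C * exp (k * (2 * pi / n))) / ennreal (norm A)
      \<le> (MIN i\<in>{..<n}. exposure_time (spirals k n i) 1 A) / ennreal (norm A)"
    by (rule divide_right_mono_ennreal)
  also have "ennreal (C * exp (k * (2 * pi / n))) / ennreal (norm A)
      = ennreal (C * exp (k * (2 * pi / n - \<epsilon>)))"
    using C by (simp add: A_def norm_polar divide_ennreal exp_diff right_diff_distrib)
  finally show ?thesis
    by (simp add: A_def C_def)
qed

lemma search_cost_spirals:
  assumes "k > 0" "n > 0"
  shows "search_cost punctured_plane n (\<lambda>_. 1) (spirals k n)
    = ennreal (sqrt (1 + k\<^sup>2) / k * exp (2 * pi * k / n))" (is "?cost = ennreal ?U")
proof (rule antisym)
  show "?cost \<le> ennreal ?U"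
    unfolding search_cost_def using assms by (intro SUP_least exposure_ratio_le)
next
  \<comment> \<open>The bound in \<open>ex_spiral_exposes\<close> is strict, so no single point
    attains the cost. The lower bound is the limit over test points approaching the spiral of agent
    \<open>0\<close> at radius \<open>1\<close> from outside.\<close>
  have "((\<lambda>\<epsilon>. ennreal (sqrt (1 + k\<^sup>2) / k * exp (k * (2 * pi / n - \<epsilon>))))
      \<longlongrightarrow> ennreal (sqrt (1 + k\<^sup>2) / k * exp (k * (2 * pi / n - 0)))) (at_right 0)"
    by (intro tendsto_intros tendsto_ennrealI)
  then have "((\<lambda>\<epsilon>. ennreal (sqrt (1 + k\<^sup>2) / k * exp (k * (2 * pi / n - \<epsilon>))))
      \<longlongrightarrow> ennreal ?U) (at_right 0)"
    by (simp add: ac_simps)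
  moreover have "\<forall>\<^sub>F \<epsilon> in at_right 0.
      ennreal (sqrt (1 + k\<^sup>2) / k * exp (k * (2 * pi / n - \<epsilon>))) \<le> ?cost"
    unfolding search_cost_def
  proof (rule eventually_at_right_less[THEN eventually_mono])
    fix \<epsilon> :: real
    assume "0 < \<epsilon>"
    then show "ennreal (sqrt (1 + k\<^sup>2) / k * exp (k * (2 * pi / n - \<epsilon>)))
      \<le> (SUP A\<in>punctured_plane. (MIN i\<in>{..<n}. exposure_time (spirals k n i) 1 A) / ennreal (norm A))"
      by (intro SUP_upper2[where i = "polar (exp (k * \<epsilon>)) 0"] polar_in_punctured_plane
            exposure_ratio_ge assms) simp_all
  qed
  ultimately show "ennreal ?U \<le> ?cost"
    by (rule tendsto_upperbound) simp
qed

section \<open>The positive root of the cubic\<close>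

lemma cardano_real_root:
  fixes p :: real
  assumes "p > 0"
  defines "k \<equiv> root 3 (sqrt (p\<^sup>2 + 1 / 27) + p) - root 3 (sqrt (p\<^sup>2 + 1 / 27) - p)"
  shows "k > 0" "k ^ 3 + k = 2 * p"
proof -
  \<comment> \<open>Cardano's substitution \<open>k = u - v\<close> gives
    \<open>k ^ 3 = u ^ 3 - v ^ 3 - 3 * (u * v) * k\<close>. The radicand is chosen so that
    \<open>u ^ 3 - v ^ 3 = 2 * p\<close> and \<open>u * v = 1 / 3\<close>.\<close>
  define u where "u = root 3 (sqrt (p\<^sup>2 + 1 / 27) + p)"
  define v where "v = root 3 (sqrt (p\<^sup>2 + 1 / 27) - p)"
  show "k > 0"
    using assms by (simp add: k_def)
  have cubes: "u ^ 3 = sqrt (p\<^sup>2 + 1 / 27) + p" "v ^ 3 = sqrt (p\<^sup>2 + 1 / 27) - p"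
    by (simp_all add: u_def v_def odd_real_root_pow)
  have "(u * v) ^ 3 = (sqrt (p\<^sup>2 + 1 / 27))\<^sup>2 - p\<^sup>2"
    by (simp add: power_mult_distrib cubes algebra_simps power2_eq_square)
  also have "\<dots> = (1 / 3) ^ 3"
    by (simp add: power3_eq_cube)
  finally have "u * v = 1 / 3"
    by (metis odd_real_root_power_cancel odd_numeral)
  moreover have "(u - v) ^ 3 = u ^ 3 - v ^ 3 - 3 * (u * v) * (u - v)"
    by (simp add: algebra_simps power3_eq_cube)
  ultimately show "k ^ 3 + k = 2 * p"
    by (simp add: cubes k_def flip: u_def v_def)
qed

text \<open>Both summands increase with the argument, the linear one strictly, so the map is
  injective.\<close>

lemma cubic_root_unique:
  fixes x y :: real
  assumes "x ^ 3 + x = y ^ 3 + y"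
  shows "x = y"
  using power_mono_odd[of 3 x y] power_mono_odd[of 3 y x] assms
  by (cases x y rule: linorder_cases) auto

theorem theorem1:
  fixes n :: nat
  assumes "n > 0"
  shows "(\<exists>!k::real. k > 0 \<and> k ^ 3 + k = real n / (2 * pi)) \<and>
    kappa n =
      root 3 (sqrt ((real n)\<^sup>2 / (16 * pi\<^sup>2) + 1 / 27) + real n / (4 * pi))
      - root 3 (sqrt ((real n)\<^sup>2 / (16 * pi\<^sup>2) + 1 / 27) - real n / (4 * pi)) \<and>
    MSP_admits punctured_plane n (\<lambda>_. 1) (ennreal (U_bound n))"
proof -
  define p where "p = real n / (4 * pi)"
  have p: "p > 0" "(real n)\<^sup>2 / (16 * pi\<^sup>2) = p\<^sup>2" "real n / (2 * pi) = 2 * p"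
    using assms by (simp_all add: p_def power_divide power_mult_distrib)
  \<comment> \<open>The spirals work for every positive growth rate. The logarithm of their cost has
    derivative \<open>2 * pi / n - 1 / (k ^ 3 + k)\<close> in \<open>k\<close>, so the root of the
    cubic is the cheapest rate.\<close>
  define k where "k = root 3 (sqrt (p\<^sup>2 + 1 / 27) + p) - root 3 (sqrt (p\<^sup>2 + 1 / 27) - p)"
  have k: "k > 0" "k ^ 3 + k = 2 * p"
    using cardano_real_root[OF p(1)] by (simp_all add: k_def)
  then have ex1: "\<exists>!k::real. k > 0 \<and> k ^ 3 + k = real n / (2 * pi)"
    unfolding p(3) by (metis cubic_root_unique)
  have kappa: "kappa n = k"
    unfolding kappa_def using k p(3) by (intro the1_equality ex1) simp
  have "MSP_admits punctured_plane n (\<lambda>_. 1) (ennreal (U_bound n))"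
    unfolding MSP_admits_def U_bound_def kappa
    using feasible_spirals[OF k(1) assms] search_cost_spirals[OF k(1) assms] by blast
  with ex1 kappa show ?thesis
    unfolding p(2) k_def p_def by blast
qed

end
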